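(* If $G$ is a connected graph of order $n$ with at most $k = o(\sqrt{n})$ cycles, then $\operatorname{th}_c(G) \leq \left(\frac{\sqrt{14}}{2} + o(1)\right)\sqrt{n}$. That is, for every function $k:\mathbb{N}\to\mathbb{N}$ with $k(n)/\sqrt{n} \to 0$ as $n\to\infty$ and every $\varepsilon > 0$, there is $N$ such that for all $n \ge N$, every connected graph $G$ of order $n$ with at most $k(n)$ cycles satisfies $\operatorname{th}_c(G) \leq \left(\frac{\sqrt{14}}{2} + \varepsilon\right)\sqrt{n}$.
   Context: Graphs are finite, simple and undirected; the order of a graph is its number of vertices. The number of cycles of $G$ is the number of subgraphs of $G$ that are (simple) cycles. In the cop versus robber game on a graph $G$, a team of cops choose their initial positions at vertices of $G$, followed by the robber (positions are visible to both sides). Multiple cops may occupy the same vertex. In each round, every cop may stay at their current vertex or move to a neighboring vertex, and then the robber may stay or move to a neighboring vertex. The cops try to occupy the same vertex as the robber (capture), while the robber tries to avoid being captured. For a positive integer $j$, $\operatorname{capt}_j(G)$ is the number of rounds needed for $j$ cops to capture the robber on $G$ if the cops and robber play optimally ($\infty$ if $j$ cops cannot guarantee capture). The throttling number is $\operatorname{th}_c(G) = \min_j (j + \operatorname{capt}_j(G))$ over all positive integers $j$. *)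

theory Defs
  imports
    Complex_Main
    "HOL-Library.Extended_Real"
    "Graph_Theory.Graph_Theory"
begin

text \<open>
  A finite simple undirected graph is a \<^locale>\<open>pair_graph\<close>, i.e. a finite loop-free
  symmetric digraph without parallel arcs; the edge \<open>uv\<close> is the pair of arcs
  \<open>(u, v)\<close>, \<open>(v, u)\<close>.
\<close>

text \<open>
  The library notion of a cycle is a closed arc walk, so it admits \<open>[(u, v), (v, u)]\<close>, and a
  cycle of a simple graph corresponds to several such walks.  Here a cycle is the graph traversed
  by a closed arc walk of length at least 3 without repeated vertices, and cycles of \<open>G\<close> are
  counted as subgraphs.
\<close>

definition is_cycle_graph :: "'a pair_pre_digraph \<Rightarrow> bool" where
  "is_cycle_graph H \<longleftrightarrow> pair_graph H \<and>
     (\<exists>p. pre_digraph.cycle (with_proj H) p \<and> 3 \<le> length p \<and>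
          pverts H = fst ` set p \<and> parcs H = set p \<union> (set p)\<inverse>)"

definition num_cycles :: "'a pair_pre_digraph \<Rightarrow> nat" where
  "num_cycles G = card {H. subgraph (with_proj H) (with_proj G) \<and> is_cycle_graph H}"

definition game_step :: "'a pair_pre_digraph \<Rightarrow> 'a \<Rightarrow> 'a \<Rightarrow> bool" where
  "game_step G u v \<longleftrightarrow> v = u \<or> u \<rightarrow>\<^bsub>with_proj G\<^esub> v"

text \<open>
  \<open>cops_capture G t c r\<close>: with the cops at the positions listed in \<open>c\<close>, the robber at \<open>r\<close> and
  the cops to move, the cops can force the robber to be captured within \<open>t\<close> further rounds.
  The robber is captured as soon as he shares a vertex with a cop, be it by the placement, by a
  move of the cops or by his own move; the latter two belong to the current round.
\<close>

primrec cops_capture :: "'a pair_pre_digraph \<Rightarrow> nat \<Rightarrow> 'a list \<Rightarrow> 'a \<Rightarrow> bool" where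
  "cops_capture G 0 c r \<longleftrightarrow> r \<in> set c"
| "cops_capture G (Suc t) c r \<longleftrightarrow> r \<in> set c \<or>
     (\<exists>c'. list_all2 (game_step G) c c' \<and>
           (r \<in> set c' \<or> (\<forall>r'. game_step G r r' \<longrightarrow> cops_capture G t c' r')))"

text \<open>The initial placement is not counted as a round.\<close>

definition capt :: "nat \<Rightarrow> 'a pair_pre_digraph \<Rightarrow> enat" where
  "capt j G = (INF t \<in> {t. \<exists>c. length c = j \<and> set c \<subseteq> pverts G \<and>
                              (\<forall>r \<in> pverts G. cops_capture G t c r)}. enat t)"

definition th_c :: "'a pair_pre_digraph \<Rightarrow> enat" where
  "th_c G = (INF j \<in> {1..}. enat j + capt j G)"

end

theory Submission
  imports Defs
begin

text \<open>
  At most \<open>k\<close> edges lie outside a spanning tree \<open>T\<close>, since their fundamental cycles are distinct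
  (\<open>card_non_tree_edges_le\<close>).  One stationary cop on an end of each of them confines the robber to
  \<open>T\<close>, at a cost of only \<open>k = o(sqrt n)\<close>.  On \<open>T\<close>, cops on the centres of balls of radius \<open>t\<close> that cover
  all vertices win within \<open>t\<close> rounds by walking towards the robber (\<open>chase\<close>).  It remains to find
  \<open>t\<close> such that \<open>t\<close> plus the number of balls needed, \<open>\<gamma> t\<close>, is small.

  A tree contains \<open>\<gamma> t\<close> points whose pairwise distances exceed \<open>2t\<close> (\<open>ex_cover_packing\<close>).  If there
  are at least two, the disjoint balls of radius \<open>t\<close> around them have more than \<open>t\<close> vertices each,
  which gives \<open>\<gamma> t \<le> n / (t + 1)\<close> and a throttling number of about \<open>2 sqrt n\<close>.  This bound is
  nearly attained for one radius at a time but not for two at once: if \<open>\<gamma> t\<close> is close to \<open>n / t\<close>,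
  then almost all vertices lie on paths of length \<open>t\<close> that start at the points of the packing, and a
  slightly larger ball that contains one such path spills over into others, which leaves room for
  fewer of these balls.  The quantitative form, for \<open>\<gamma> (t + \<delta>) \<ge> 2\<close> and \<open>\<delta> \<le> t\<close>, is
  \<open>(t - \<delta>) * \<gamma> t + 2\<delta> * \<gamma> (t + \<delta>) \<le> n\<close> (\<open>two_packings_le_card\<close>).

  With \<open>t = 3s\<close> and \<open>\<delta> = s\<close> this reads \<open>\<gamma> (3s) + \<gamma> (4s) \<le> n / (2s)\<close>, so that one of the radii \<open>3s\<close>
  and \<open>4s\<close> leads to at most \<open>n / (4s) + 7s / 2\<close> (\<open>th_c_bound\<close>).  The choice \<open>s = sqrt (n / 14)\<close>
  minimizes this bound and gives \<open>sqrt 14 / 2 * sqrt n\<close>.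
\<close>

section \<open>Distances and packings\<close>

definition gdist :: "'a rel \<Rightarrow> 'a \<Rightarrow> 'a \<Rightarrow> nat" where
  "gdist E x y = (LEAST k. (x, y) \<in> E ^^ k)"

lemma gdist_le: "(x, y) \<in> E ^^ k \<Longrightarrow> gdist E x y \<le> k"
  unfolding gdist_def by (rule Least_le)

lemma relpow_gdist: "(x, y) \<in> E\<^sup>* \<Longrightarrow> (x, y) \<in> E ^^ gdist E x y"
  unfolding gdist_def rtrancl_power by (auto intro: LeastI_ex)

lemma relpow_sym:
  assumes "sym E" "(x, y) \<in> E ^^ k" shows "(y, x) \<in> E ^^ k"
  using assms(2)
proof (induction k arbitrary: y)
  case (Suc k)
  from Suc.prems obtain z where "(x, z) \<in> E ^^ k" "(z, y) \<in> E" by auto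
  with Suc.IH assms(1) show ?case by (blast intro: relpow_Suc_I2 dest: symD)
qed simp

locale connected_graph =
  fixes V :: "'a set" and E :: "'a rel"
  assumes finite_V: "finite V"
    and edges_V: "E \<subseteq> V \<times> V"
    and sym_E: "sym E"
    and conn: "x \<in> V \<Longrightarrow> y \<in> V \<Longrightarrow> (x, y) \<in> E\<^sup>*"
begin

abbreviation d :: "'a \<Rightarrow> 'a \<Rightarrow> nat" where "d \<equiv> gdist E"

lemma d_walk: "x \<in> V \<Longrightarrow> y \<in> V \<Longrightarrow> (x, y) \<in> E ^^ d x y"
  by (simp add: conn relpow_gdist)

lemma d_self [simp]: "d x x = 0"
  using gdist_le[of x x 0] by simp

lemma d_0_D: "x \<in> V \<Longrightarrow> y \<in> V \<Longrightarrow> d x y = 0 \<Longrightarrow> x = y"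
  using d_walk[of x y] by simp

lemma d_sym: "x \<in> V \<Longrightarrow> y \<in> V \<Longrightarrow> d x y = d y x"
  using gdist_le[OF relpow_sym[OF sym_E d_walk[of x y]]] gdist_le[OF relpow_sym[OF sym_E d_walk[of y x]]]
  by simp

lemma d_triangle:
  assumes "x \<in> V" "y \<in> V" "z \<in> V" shows "d x z \<le> d x y + d y z"
  using assms by (intro gdist_le) (auto simp: relpow_add intro: d_walk)

lemma geodesic:
  assumes "x \<in> V" "z \<in> V"
  shows "\<exists>w. (\<forall>i \<le> d x z. w i \<in> V \<and> d x (w i) = i) \<and>
             (\<forall>i j. i \<le> j \<longrightarrow> j \<le> d x z \<longrightarrow> d (w i) (w j) \<le> j - i)"
proof -
  let ?n = "d x z"
  obtain w where w: "w 0 = x" "w ?n = z" "\<And>i. i < ?n \<Longrightarrow> (w i, w (Suc i)) \<in> E"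
    using d_walk[OF assms] unfolding relpow_fun_conv by blast
  have seg: "(w i, w (i + k)) \<in> E ^^ k" if "i + k \<le> ?n" for i k
    using that by (induction k) (use w(3) in auto)
  have inV: "w i \<in> V" if "i \<le> ?n" for i
    using that w(1,3) edges_V assms(1) by (cases i) (auto simp: less_eq_Suc_le)
  have le: "d (w i) (w j) \<le> j - i" if "i \<le> j" "j \<le> ?n" for i j
    using gdist_le[OF seg[of i "j - i"]] that by simp
  have "d x (w i) = i" if i: "i \<le> ?n" for i
    using le[of 0 i] le[of i ?n] d_triangle[OF assms(1) inV[OF i] assms(2)] i w(1,2) by simp
  with inV le show ?thesis by blast
qed

text \<open>
  Around each point of the packing \<open>P\<close> only the core, the first \<open>t - \<delta>\<close> vertices of a
  geodesic, is used.  Cores of different points are more than \<open>2\<delta>\<close> apart, hence a geodesic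
  of length \<open>t + \<delta>\<close> has at least \<open>2\<delta>\<close> vertices outside all cores: if it meets two cores, the
  stretch between two consecutive ones suffices; if it meets at most one core, it loses
  at most \<open>t - \<delta>\<close> of its \<open>t + \<delta> + 1\<close> vertices.  The geodesics that start at points of
  \<open>Q\<close> are disjoint, so the cores and these remainders fit side by side into the graph.
\<close>

lemma two_packings_le_card:
  assumes PV: "P \<subseteq> V" and QV: "Q \<subseteq> V" and \<delta>: "\<delta> \<le> t" and Q2: "2 \<le> card Q"
    and P: "\<And>p p'. p \<in> P \<Longrightarrow> p' \<in> P \<Longrightarrow> p \<noteq> p' \<Longrightarrow> 2 * t < d p p'"
    and Q: "\<And>q q'. q \<in> Q \<Longrightarrow> q' \<in> Q \<Longrightarrow> q \<noteq> q' \<Longrightarrow> 2 * (t + \<delta>) < d q q'"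
  shows "(t - \<delta>) * card P + 2 * \<delta> * card Q \<le> card V"
proof -
  let ?n = "t + \<delta>"
  obtain q1 q2 where q12: "q1 \<in> Q" "q2 \<in> Q" "q1 \<noteq> q2"
    using Q2 by (auto simp: numeral_2_eq_2 card_le_Suc_iff)
  have "\<forall>x\<in>V. \<exists>w. (\<forall>i \<le> ?n. w i \<in> V \<and> d x (w i) = i) \<and>
             (\<forall>i j. i \<le> j \<longrightarrow> j \<le> ?n \<longrightarrow> d (w i) (w j) \<le> j - i)"
  proof
    fix x assume x: "x \<in> V"
    have "2 * ?n < d q1 x + d x q2"
      using Q[OF q12] d_triangle[of q1 x q2] x q12 QV by (meson less_le_trans subsetD)
    moreover have "d q1 x = d x q1" using d_sym x q12 QV by auto
    ultimately have "?n \<le> d x q1 \<or> ?n \<le> d x q2" by arith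
    then obtain z where z: "z \<in> V" "?n \<le> d x z" using q12 QV by blast
    obtain w where "\<forall>i \<le> d x z. w i \<in> V \<and> d x (w i) = i"
        "\<forall>i j. i \<le> j \<longrightarrow> j \<le> d x z \<longrightarrow> d (w i) (w j) \<le> j - i"
      using geodesic[OF x z(1)] by blast
    with z(2) show "\<exists>w. (\<forall>i \<le> ?n. w i \<in> V \<and> d x (w i) = i) \<and>
        (\<forall>i j. i \<le> j \<longrightarrow> j \<le> ?n \<longrightarrow> d (w i) (w j) \<le> j - i)"
      by (intro exI[of _ w]) simp
  qed
  from bchoice[OF this] obtain w
    where w: "\<forall>x\<in>V. (\<forall>i \<le> ?n. w x i \<in> V \<and> d x (w x i) = i) \<and>
                   (\<forall>i j. i \<le> j \<longrightarrow> j \<le> ?n \<longrightarrow> d (w x i) (w x j) \<le> j - i)" ..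
  have wV: "w x i \<in> V" and wd: "d x (w x i) = i" if "x \<in> V" "i \<le> ?n" for x i
    using w that by auto
  have wle: "d (w x i) (w x j) \<le> j - i" if "x \<in> V" "i \<le> j" "j \<le> ?n" for x i j
    using w that by auto
  have inj: "inj_on (w x) {..?n}" if "x \<in> V" for x
    by (rule inj_on_inverseI[of _ "d x"]) (simp add: wd that)

  define K where "K p = w p ` {..<t - \<delta>}" for p
  define C where "C = (\<Union>p\<in>P. K p)"
  define B where "B q = w q ` {..?n} - C" for q
  have KV: "K p \<subseteq> V" and Kd: "\<And>y. y \<in> K p \<Longrightarrow> d p y < t - \<delta>" and cardK: "card (K p) = t - \<delta>"
    if "p \<in> P" for p
  proof -
    have p: "p \<in> V" using that PV by auto
    show "K p \<subseteq> V" "\<And>y. y \<in> K p \<Longrightarrow> d p y < t - \<delta>" using wV[OF p] wd[OF p] by (auto simp: K_def)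
    show "card (K p) = t - \<delta>"
      unfolding K_def by (subst card_image) (auto intro: inj_on_subset[OF inj[OF p]])
  qed
  have apart: "2 * \<delta> + 2 < d y y'" if "p \<in> P" "p' \<in> P" "p \<noteq> p'" "y \<in> K p" "y' \<in> K p'" for p p' y y'
  proof -
    have V: "p \<in> V" "p' \<in> V" "y \<in> V" "y' \<in> V" using that KV PV by auto
    have "d p p' \<le> d p y + d y y' + d y' p'"
      using d_triangle[of p y p'] d_triangle[of y y' p'] V by linarith
    then show ?thesis
      using Kd[OF that(1,4)] Kd[OF that(2,5)] P[OF that(1-3)] d_sym[OF V(2,4)] by linarith
  qed
  have cardC: "card C = (t - \<delta>) * card P"
  proof -
    have "K p \<inter> K p' = {}" if "p \<in> P" "p' \<in> P" "p \<noteq> p'" for p p'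
    proof -
      have False if "y \<in> K p" "y \<in> K p'" for y
        using apart[OF \<open>p \<in> P\<close> \<open>p' \<in> P\<close> \<open>p \<noteq> p'\<close> that] by simp
      then show ?thesis by blast
    qed
    then have "card C = (\<Sum>p\<in>P. card (K p))"
      unfolding C_def using finite_subset[OF PV finite_V] by (intro card_UN_disjoint) (auto simp: K_def)
    then show ?thesis by (simp add: cardK)
  qed
  have cardB: "2 * \<delta> \<le> card (B q)" if q: "q \<in> Q" for q
  proof -
    have qV: "q \<in> V" using q QV by auto
    \<comment> \<open>\<open>two k\<close>: indices at distance \<open>k\<close> on the geodesic lie in different cores.
      For the least such \<open>k\<close>, no index between them lies in a core.\<close>
    define two where "two k \<longleftrightarrow> (\<exists>i p p'. i + k \<le> ?n \<and> 0 < k \<and> p \<in> P \<and> p' \<in> P \<and> p \<noteq> p' \<and>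
                                w q i \<in> K p \<and> w q (i + k) \<in> K p')" for k
    have twoI: "two (j - i)"
      if "i < j" "j \<le> ?n" "p \<in> P" "p' \<in> P" "p \<noteq> p'" "w q i \<in> K p" "w q j \<in> K p'" for i j p p'
      unfolding two_def using that by (intro exI[of _ i] exI[of _ p] exI[of _ p']) simp
    show ?thesis
    proof (cases "\<exists>k. two k")
      case True
      define k where "k = (LEAST k. two k)"
      have "two k" and least: "\<And>l. l < k \<Longrightarrow> \<not> two l"
        using True unfolding k_def by (auto intro: LeastI_ex dest: not_less_Least)
      then obtain i p p' where k: "i + k \<le> ?n" "0 < k" "p \<in> P" "p' \<in> P" "p \<noteq> p'"
          "w q i \<in> K p" "w q (i + k) \<in> K p'"
        unfolding two_def by blast
      have "2 * \<delta> + 2 < k"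
        using apart[OF k(3-7)] wle[OF qV, of i "i + k"] k(1) by simp
      moreover have "w q ` {i<..<i + k} \<subseteq> B q"
      proof
        fix y assume "y \<in> w q ` {i<..<i + k}"
        then obtain m where m: "y = w q m" "i < m" "m < i + k" by auto
        have "False" if yC: "y \<in> C"
        proof -
          obtain p'' where p'': "p'' \<in> P" "w q m \<in> K p''" using yC m unfolding C_def by blast
          show False
          proof (cases "p'' = p")
            case True
            with p'' k m have "two (i + k - m)" by (intro twoI[of m "i + k" p p']) simp_all
            moreover have "i + k - m < k" using m by simp
            ultimately show False using least by blast
          next
            case False
            with p'' k m have "two (m - i)" by (intro twoI[of i m p p'']) simp_all
            moreover have "m - i < k" using m by simp
            ultimately show False using least by blast
          qed
        qed
        then show "y \<in> B q" using m k by (auto simp: B_def)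
      qed
      moreover have "card (w q ` {i<..<i + k}) = k - 1"
        using k(1) by (subst card_image) (auto intro: inj_on_subset[OF inj[OF qV]])
      ultimately show ?thesis
        using card_mono[of "B q" "w q ` {i<..<i + k}"] by (simp add: B_def)
    next
      case False
      have "\<exists>p. w q ` {..?n} \<inter> C \<subseteq> K p \<and> card (K p) \<le> t - \<delta>"
      proof (cases "w q ` {..?n} \<inter> C = {}")
        case True
        have "card (K q) \<le> t - \<delta>" using card_image_le[of "{..<t - \<delta>}" "w q"] by (simp add: K_def)
        with True show ?thesis by auto
      next
        case ne: False
        then obtain i p where i: "i \<le> ?n" "p \<in> P" "w q i \<in> K p" by (auto simp: C_def)
        have "w q j \<in> K p" if j: "j \<le> ?n" "w q j \<in> C" for j
        proof (rule ccontr)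
          assume no: "w q j \<notin> K p"
          obtain p' where p': "p' \<in> P" "w q j \<in> K p'" using j by (auto simp: C_def)
          with no have ne: "p \<noteq> p'" by auto
          have "i \<noteq> j" using no i by auto
          then consider "i < j" | "j < i" by linarith
          then show False
          proof cases
            case 1
            then show False using False twoI[OF _ j(1) i(2) p'(1) ne i(3) p'(2)] by blast
          next
            case 2
            then show False using False twoI[OF _ i(1) p'(1) i(2) ne[symmetric] p'(2) i(3)] by blast
          qed
        qed
        then have "w q ` {..?n} \<inter> C \<subseteq> K p" by auto
        with cardK[OF i(2)] show ?thesis by (intro exI[of _ p]) simp
      qed
      then obtain p where p: "w q ` {..?n} \<inter> C \<subseteq> K p" "card (K p) \<le> t - \<delta>" by blast
      have "card (w q ` {..?n}) = ?n + 1" using inj[OF qV] by (simp add: card_image)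
      moreover have "card (w q ` {..?n} \<inter> C) \<le> card (K p)"
        using p(1) by (intro card_mono) (auto simp: K_def)
      ultimately show ?thesis
        using p(2) card_Diff_subset_Int[of "w q ` {..?n}" C] \<delta> unfolding B_def by simp
    qed
  qed
  have BV: "B q \<subseteq> V" if "q \<in> Q" for q using that QV wV by (auto simp: B_def)
  have disjB: "B q \<inter> B q' = {}" if qq: "q \<in> Q" "q' \<in> Q" "q \<noteq> q'" for q q'
  proof (rule ccontr)
    assume "B q \<inter> B q' \<noteq> {}"
    then obtain i j where ij: "i \<le> ?n" "j \<le> ?n" "w q i = w q' j" by (auto simp: B_def)
    have V: "q \<in> V" "q' \<in> V" using qq QV by auto
    then have "d q q' \<le> i + j"
      using d_triangle[OF V(1) wV[OF V(2) ij(2)] V(2)] wd[OF V(1) ij(1)] wd[OF V(2) ij(2)] ij(3)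
        d_sym[OF V(2) wV[OF V(2) ij(2)]] by simp
    then show False using Q[OF qq] ij by simp
  qed
  have finQ: "finite Q" using QV finite_V finite_subset by auto
  have CV: "C \<subseteq> V" using KV by (auto simp: C_def)
  have "2 * \<delta> * card Q \<le> (\<Sum>q\<in>Q. card (B q))"
    using sum_mono[of Q "\<lambda>_. 2 * \<delta>" "\<lambda>q. card (B q)"] cardB by (simp add: mult.commute)
  also have "\<dots> = card (\<Union>q\<in>Q. B q)"
    using finQ disjB by (intro card_UN_disjoint[symmetric]) (auto simp: B_def)
  finally have "(t - \<delta>) * card P + 2 * \<delta> * card Q \<le> card C + card (\<Union>q\<in>Q. B q)" using cardC by simp
  also have "\<dots> = card (C \<union> (\<Union>q\<in>Q. B q))"
    using finQ finite_subset[OF CV finite_V] by (intro card_Un_disjoint[symmetric]) (auto simp: B_def)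
  also have "\<dots> \<le> card V" using CV BV finite_V by (intro card_mono) auto
  finally show ?thesis .
qed

end

section \<open>Covers and packings in trees\<close>

locale rooted_tree =
  fixes V :: "'a set" and root :: 'a and par :: "'a \<Rightarrow> 'a" and depth :: "'a \<Rightarrow> nat"
  assumes finite_verts: "finite V" and root_V: "root \<in> V" and depth_root: "depth root = 0"
    and par_V: "v \<in> V \<Longrightarrow> v \<noteq> root \<Longrightarrow> par v \<in> V"
    and depth_par: "v \<in> V \<Longrightarrow> v \<noteq> root \<Longrightarrow> depth v = Suc (depth (par v))"
begin

definition edges :: "'a rel" where
  "edges = {(v, par v) |v. v \<in> V - {root}} \<union> {(par v, v) |v. v \<in> V - {root}}"

lemma edges_cases:
  assumes "(a, b) \<in> edges"
  obtains "a \<in> V" "a \<noteq> root" "b = par a" "depth a = Suc (depth b)"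
    | "b \<in> V" "b \<noteq> root" "a = par b" "depth b = Suc (depth a)"
  using assms depth_par by (auto simp: edges_def)

lemma edges_subset: "edges \<subseteq> V \<times> V"
  using par_V by (auto simp: edges_def)

lemma sym_edges: "sym edges"
  by (rule symI) (auto simp: edges_def)

lemma ancestor:
  assumes "x \<in> V" "k \<le> depth x"
  shows "(par ^^ k) x \<in> V" "depth ((par ^^ k) x) = depth x - k" "(x, (par ^^ k) x) \<in> edges ^^ k"
proof -
  have "(par ^^ k) x \<in> V \<and> depth ((par ^^ k) x) = depth x - k \<and> (x, (par ^^ k) x) \<in> edges ^^ k"
    using assms(2)
  proof (induction k)
    case (Suc k)
    let ?y = "(par ^^ k) x"
    have y: "?y \<in> V" "depth ?y = depth x - k" "(x, ?y) \<in> edges ^^ k" using Suc by auto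
    then have "?y \<noteq> root" using Suc.prems depth_root by auto
    then have "par ?y \<in> V" "depth (par ?y) = depth x - Suc k" "(?y, par ?y) \<in> edges"
      using y par_V depth_par[of ?y] by (auto simp: edges_def)
    with y(3) show ?case by (auto intro: relpow_Suc_I)
  qed (use assms in simp)
  then show "(par ^^ k) x \<in> V" "depth ((par ^^ k) x) = depth x - k" "(x, (par ^^ k) x) \<in> edges ^^ k"
    by auto
qed

lemma depth_0_iff: "v \<in> V \<Longrightarrow> depth v = 0 \<longleftrightarrow> v = root"
  using depth_par depth_root by fastforce

lemma ancestor_root: "x \<in> V \<Longrightarrow> (par ^^ depth x) x = root"
  using ancestor[of x "depth x"] depth_0_iff by simp

sublocale connected_graph V edges
proof
  fix x y assume xy: "x \<in> V" "y \<in> V"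
  have to_root: "(v, root) \<in> edges\<^sup>*" if "v \<in> V" for v
    using ancestor(3)[of v "depth v"] ancestor_root[OF that] that by (auto intro: relpow_imp_rtrancl)
  have "(root, y) \<in> edges\<^sup>*" using to_root[OF xy(2)] sym_edges by (meson sym_rtrancl symD)
  with to_root[OF xy(1)] show "(x, y) \<in> edges\<^sup>*" by simp
qed (use finite_verts edges_subset sym_edges in auto)

text \<open>
  The bound \<open>k \<le> depth x\<close> matters: \<open>par\<close> is arbitrary at the root, so its iterates beyond
  the root carry no information.
\<close>

definition desc :: "'a \<Rightarrow> 'a \<Rightarrow> bool" where
  "desc v x \<longleftrightarrow> (\<exists>k \<le> depth x. (par ^^ k) x = v)"

lemma desc_refl: "desc v v"
  unfolding desc_def by (rule exI[of _ 0]) simp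

lemma desc_root: "x \<in> V \<Longrightarrow> desc root x"
  using ancestor_root unfolding desc_def by blast

lemma desc_leave:
  assumes "(a, b) \<in> edges" "desc v a" "\<not> desc v b" shows "a = v \<and> b = par v \<and> v \<noteq> root"
  using assms(1)
proof (cases rule: edges_cases)
  case 1
  obtain k where k: "k \<le> depth a" "(par ^^ k) a = v" using assms(2) by (auto simp: desc_def)
  have "k = 0"
  proof (cases k)
    case (Suc j)
    then have "(par ^^ j) b = v" "j \<le> depth b" using k 1 by (auto simp: funpow_swap1)
    then show ?thesis using assms(3) unfolding desc_def by blast
  qed
  then show ?thesis using k 1 by simp
next
  case 2
  obtain k where "k \<le> depth a" "(par ^^ k) a = v" using assms(2) by (auto simp: desc_def)
  then have "(par ^^ Suc k) b = v" "Suc k \<le> depth b" using 2 by (auto simp: funpow_swap1)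
  then show ?thesis using assms(3) unfolding desc_def by blast
qed

lemma walk_leaves_at_top:
  assumes "(x, u) \<in> edges ^^ k" "desc v x" "\<not> desc v u"
  shows "\<exists>i \<le> k. (x, v) \<in> edges ^^ i \<and> (v, u) \<in> edges ^^ (k - i)"
  using assms
proof (induction k arbitrary: x)
  case (Suc k)
  obtain y where y: "(x, y) \<in> edges" "(y, u) \<in> edges ^^ k"
    using Suc.prems(1) by (meson relpow_Suc_E2)
  show ?case
  proof (cases "desc v y")
    case True
    from Suc.IH[OF y(2) True Suc.prems(3)] obtain i
      where i: "i \<le> k" "(y, v) \<in> edges ^^ i" "(v, u) \<in> edges ^^ (k - i)" by blast
    with y(1) have "(x, v) \<in> edges ^^ Suc i" by (meson relpow_Suc_I2)
    with i show ?thesis by (intro exI[of _ "Suc i"]) simp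
  next
    case False
    then have "x = v" using desc_leave y(1) Suc.prems(2) by blast
    then show ?thesis using Suc.prems(1) by (intro exI[of _ 0]) simp
  qed
qed auto

lemma depth_walk: "(x, y) \<in> edges ^^ k \<Longrightarrow> depth x \<le> depth y + k"
proof (induction k arbitrary: y)
  case (Suc k)
  then obtain z where "(x, z) \<in> edges ^^ k" "(z, y) \<in> edges" by auto
  with Suc.IH[of z] show ?case by (auto elim: edges_cases)
qed simp

lemma d_desc_le:
  assumes "x \<in> V" "desc v x" shows "d v x \<le> depth x - depth v" "depth v \<le> depth x"
proof -
  obtain k where k: "k \<le> depth x" "(par ^^ k) x = v" using assms(2) by (auto simp: desc_def)
  then have "(x, v) \<in> edges ^^ k" "depth v = depth x - k" using ancestor[OF assms(1) k(1)] by auto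
  then show "d v x \<le> depth x - depth v" "depth v \<le> depth x"
    using gdist_le[OF relpow_sym[OF sym_edges]] k by auto
qed

text \<open>
  In a tree, covering with balls of radius \<open>r\<close> and packing disjoint balls of radius \<open>r\<close> are dual.
  The greedy choice shows it: pick a deepest uncovered vertex \<open>x\<close> and put a centre at its
  \<open>r\<close>-th ancestor \<open>v\<close>.  The ball around \<open>v\<close> covers every vertex below \<open>v\<close> that was still
  uncovered, because none of these is deeper than \<open>x\<close>.  A vertex \<open>u\<close> that stays uncovered is
  therefore not below \<open>v\<close>, so the path from \<open>x\<close> to \<open>u\<close> passes through \<open>v\<close> and is longer than
  \<open>r + r\<close>.
\<close>

lemma ex_cover_packing:
  assumes "U \<subseteq> V"
  shows "\<exists>P C. P \<subseteq> U \<and> C \<subseteq> V \<and> card C \<le> card P \<and> (\<forall>u\<in>U. \<exists>c\<in>C. d c u \<le> r) \<and>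
               (\<forall>p\<in>P. \<forall>p'\<in>P. p \<noteq> p' \<longrightarrow> 2 * r < d p p')"
proof -
  have "finite U" using assms finite_verts finite_subset by auto
  then show ?thesis using assms
  proof (induction U rule: finite_psubset_induct)
    case (psubset U)
    show ?case
    proof (cases "U = {}")
      case True
      then show ?thesis by (intro exI[of _ "{}"]) simp
    next
      case False
      then obtain x where x: "x \<in> U" "\<And>u. u \<in> U \<Longrightarrow> depth u \<le> depth x"
      proof -
        obtain x where "x \<in> U" "Max (depth ` U) = depth x"
          using obtains_MAX[OF psubset.hyps False] by metis
        then show thesis using that[of x] psubset.hyps by (metis Max_ge finite_imageI imageI)
      qed
      have xV: "x \<in> V" using x(1) psubset.prems by auto
      \<comment> \<open>If \<open>x\<close> lies less than \<open>r\<close> below the root, the root takes the place of the ancestor.\<close>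
      define m where "m = min r (depth x)"
      define v where "v = (par ^^ m) x"
      have m: "m \<le> depth x" "m \<le> r" by (auto simp: m_def)
      note anc = ancestor[OF xV m(1), folded v_def]
      have "desc v x" using m unfolding desc_def v_def by blast
      define U' where "U' = {u \<in> U. r < d v u}"
      have not_desc: "\<not> desc v u" and depth_m: "r = m" if u: "u \<in> U'" for u
      proof -
        have uV: "u \<in> V" and "depth u \<le> depth x" and far: "r < d v u"
          using u x psubset.prems by (auto simp: U'_def)
        then show nd: "\<not> desc v u" using d_desc_le[OF uV, of v] anc(2) m by auto
        show "r = m"
        proof (rule ccontr)
          assume "r \<noteq> m"
          then have "v = root" using anc depth_0_iff[of v] by (auto simp: m_def)
          then show False using nd desc_root[OF uV] by simp
        qed
      qed
      have "x \<notin> U'" using not_desc \<open>desc v x\<close> by blast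
      then have U': "U' \<subset> U" "U' \<subseteq> V" using x(1) psubset.prems by (auto simp: U'_def)
      from psubset.IH[OF this] obtain P C where PC: "P \<subseteq> U'" "C \<subseteq> V" "card C \<le> card P" "\<forall>u\<in>U'. \<exists>c\<in>C. d c u \<le> r"
          "\<forall>p\<in>P. \<forall>p'\<in>P. p \<noteq> p' \<longrightarrow> 2 * r < d p p'"
        by blast
      have far: "2 * r < d x u" if u: "u \<in> U'" for u
      proof -
        have uV: "u \<in> V" using u psubset.prems by (auto simp: U'_def)
        obtain i where i: "i \<le> d x u" "(x, v) \<in> edges ^^ i" "(v, u) \<in> edges ^^ (d x u - i)"
          using walk_leaves_at_top[OF d_walk[OF xV uV] \<open>desc v x\<close> not_desc[OF u]] by blast
        have "r \<le> i" using depth_walk[OF i(2)] anc(2) m depth_m[OF u] by simp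
        moreover have "r < d x u - i" using gdist_le[OF i(3)] u by (simp add: U'_def)
        ultimately show ?thesis by simp
      qed
      have PU: "P \<subseteq> U" "x \<notin> P" "finite P" "P \<subseteq> V"
        using PC(1) \<open>x \<notin> U'\<close> U' finite_subset[of P V] finite_verts by auto
      have "card (insert v C) \<le> card (insert x P)"
        using PU PC(3) card_insert_le_m1[of "Suc (card P)" C v] by simp
      moreover have "\<exists>c\<in>insert v C. d c u \<le> r" if "u \<in> U" for u
        using PC(4) that by (cases "u \<in> U'") (auto simp: U'_def)
      moreover have "2 * r < d p p'" if "p \<in> insert x P" "p' \<in> insert x P" "p \<noteq> p'" for p p'
        using that PC(1,5) far d_sym[OF xV] PU(4) by (metis insert_iff subsetD)
      ultimately show ?thesis
        using PU x(1) PC(2) anc(1) by (intro exI[of _ "insert x P"] exI[of _ "insert v C"]) auto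
    qed
  qed
qed

section \<open>Chasing the robber in a tree\<close>

abbreviation avoid :: "'a set \<Rightarrow> 'a rel" where
  "avoid S \<equiv> (Restr edges (- S))\<^sup>*"

lemma avoid_sym: "(a, b) \<in> avoid S \<Longrightarrow> (b, a) \<in> avoid S"
proof -
  have "sym (Restr edges (- S))" using sym_edges by (auto simp: sym_def)
  from symD[OF sym_rtrancl[OF this]] show "(a, b) \<in> avoid S \<Longrightarrow> (b, a) \<in> avoid S" .
qed

lemma avoid_mono: "S' \<subseteq> S \<Longrightarrow> (a, b) \<in> avoid S \<Longrightarrow> (a, b) \<in> avoid S'"
  by (rule rtrancl_mono[THEN subsetD, rotated]) auto

lemma avoid_notin: "(a, b) \<in> avoid S \<Longrightarrow> a \<notin> S \<Longrightarrow> b \<notin> S"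
  by (induction rule: rtrancl_induct) auto

lemma desc_avoid:
  assumes "(b, w) \<in> avoid {par b}" "b \<in> V" "b \<noteq> root" shows "desc b w"
  using assms(1)
proof (induction rule: rtrancl_induct)
  case (step y z)
  then show ?case using desc_leave[of y z b] by auto
qed (rule desc_refl)

text \<open>
  Acyclicity of the tree: of two different neighbours of \<open>c\<close> one is a child of \<open>c\<close>, and a walk leaves
  the vertices below this child only through \<open>c\<close>.
\<close>

lemma neighbours_separated:
  assumes ca: "(c, a) \<in> edges" and cb: "(c, b) \<in> edges" and ab: "(a, b) \<in> avoid {c}"
  shows "a = b"
proof -
  have child: "a = b" if "b \<in> V" "b \<noteq> root" "c = par b" and ca: "(c, a) \<in> edges" and ab: "(b, a) \<in> avoid {c}"
    for a b
  proof -
    have desc: "desc b a" using desc_avoid[of b a] that by simp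
    have "depth b \<le> depth a"
      using d_desc_le(2)[OF _ desc] ca edges_subset by auto
    then have "depth a = depth b"
      using ca depth_par[of b] that by (auto elim!: edges_cases)
    then obtain k where "k \<le> depth a" "(par ^^ k) a = b" "depth a = depth b"
      using desc by (auto simp: desc_def)
    moreover have "a \<in> V" using ca edges_subset by auto
    ultimately have "k = 0" using ancestor(2)[of a k] by simp
    then show ?thesis using \<open>(par ^^ k) a = b\<close> by simp
  qed
  from cb show ?thesis
  proof (cases rule: edges_cases)
    case 2
    then show ?thesis using child[OF _ _ _ ca avoid_sym[OF ab]] by simp
  next
    case c: 1
    from ca show ?thesis
    proof (cases rule: edges_cases)
      case 2
      then show ?thesis using child[OF _ _ _ cb ab] by simp
    qed (use c in simp)
  qed
qed

text \<open>The neighbour of \<open>c\<close> on the path to \<open>w\<close>; it is unique because of acyclicity.\<close>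

definition toward :: "'a \<Rightarrow> 'a \<Rightarrow> 'a" where
  "toward c w = (SOME c'. (c, c') \<in> edges \<and> (c', w) \<in> avoid {c})"

lemma toward_eq:
  assumes "(c, c') \<in> edges" "(c', w) \<in> avoid {c}" shows "toward c w = c'"
  unfolding toward_def
proof (rule some_equality)
  fix a assume "(c, a) \<in> edges \<and> (a, w) \<in> avoid {c}"
  then have "(c, a) \<in> edges" "(a, c') \<in> avoid {c}"
    using rtrancl_trans[OF _ avoid_sym[OF assms(2)]] by auto
  then show "a = c'" using neighbours_separated assms(1) by blast
qed (use assms in simp)

lemma toward_cong:
  assumes "(r, w) \<in> avoid {c}" shows "toward c r = toward c w"
proof -
  have "(c', r) \<in> avoid {c} \<longleftrightarrow> (c', w) \<in> avoid {c}" for c'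
    using rtrancl_trans[OF _ assms] rtrancl_trans[OF _ avoid_sym[OF assms]] by blast
  then show ?thesis by (simp add: toward_def)
qed

lemma walk_first_step:
  assumes "(c, w) \<in> edges ^^ n" "w \<noteq> c"
  shows "\<exists>c' m. (c, c') \<in> edges \<and> (c', w) \<in> avoid {c} \<and> m < n \<and> (c', w) \<in> edges ^^ m"
  using assms
proof (induction n arbitrary: w)
  case (Suc n)
  then obtain z where z: "(c, z) \<in> edges ^^ n" "(z, w) \<in> edges" by auto
  show ?case
  proof (cases "z = c")
    case True
    then show ?thesis using z by (intro exI[of _ w] exI[of _ 0]) auto
  next
    case False
    from Suc.IH[OF z(1) False] obtain c' m
      where c': "(c, c') \<in> edges" "(c', z) \<in> avoid {c}" "m < n" "(c', z) \<in> edges ^^ m" by blast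
    have "(c', w) \<in> avoid {c}"
      using c'(2) z(2) False Suc.prems(2) by (intro rtrancl_into_rtrancl[OF c'(2)]) auto
    moreover have "(c', w) \<in> edges ^^ Suc m" using c'(4) z(2) by (meson relpow_Suc_I)
    ultimately show ?thesis using c' by (intro exI[of _ c'] exI[of _ "Suc m"]) simp
  qed
qed simp

lemma toward_step:
  assumes "c \<in> V" "w \<in> V" "w \<noteq> c"
  shows "(c, toward c w) \<in> edges" "d (toward c w) w < d c w"
proof -
  obtain c' m where c': "(c, c') \<in> edges" "(c', w) \<in> avoid {c}" "m < d c w" "(c', w) \<in> edges ^^ m"
    using walk_first_step[OF d_walk[OF assms(1,2)] assms(3)] by blast
  with toward_eq[OF c'(1,2)] gdist_le[OF c'(4)] show "(c, toward c w) \<in> edges" "d (toward c w) w < d c w"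
    by auto
qed

lemma avoid_V: "(r, w) \<in> avoid S \<Longrightarrow> r \<in> V \<Longrightarrow> w \<in> V"
  by (induction rule: rtrancl_induct) (use edges_subset in auto)

end

lemma cops_capture_now: "r \<in> set c \<Longrightarrow> cops_capture G t c r"
  by (cases t) auto

context rooted_tree
begin

text \<open>
  Cops that stay on \<open>g\<close> keep the robber on tree edges.  Every cop of \<open>m\<close> steps towards the
  robber.  A vertex \<open>w\<close> that the robber can still reach without meeting a cop lies, seen from any
  cop of \<open>m\<close>, in the same branch of the tree as the robber, so this step brings each of them closer
  to \<open>w\<close>.
  The robber gains no new territory: he could only pass the place that a cop just left by passing
  the place to which it moved.
\<close>

lemma chase:
  assumes tree: "edges \<subseteq> parcs G"
    and guard: "\<And>u v. (u, v) \<in> parcs G \<Longrightarrow> (u, v) \<in> edges \<or> u \<in> set g \<or> v \<in> set g"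
    and "set m \<subseteq> V" "r \<in> V"
    and "\<And>w. (r, w) \<in> avoid (set m \<union> set g) \<Longrightarrow> \<exists>c \<in> set m. d c w \<le> t"
  shows "cops_capture G t (m @ g) r"
  using assms(3-)
proof (induction t arbitrary: m r)
  case 0
  then obtain c where "c \<in> set m" "d c r = 0" by force
  then show ?case using 0 d_0_D[of c r] by auto
next
  case (Suc t)
  let ?S = "set m \<union> set g" and ?m' = "map (\<lambda>c. toward c r) m"
  let ?S' = "set ?m' \<union> set g"
  have step: "list_all2 (game_step G) (m @ g) (?m' @ g)" if "r \<notin> ?S"
  proof -
    have "game_step G c (toward c r)" if "c \<in> set m" for c
      using toward_step(1)[of c r] that Suc.prems \<open>r \<notin> ?S\<close> tree by (auto simp: game_step_def)
    then show ?thesis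
      by (intro list_all2_appendI) (auto simp: list_all2_conv_all_nth game_step_def)
  qed
  show ?case
  proof (cases "r \<in> ?S \<or> r \<in> ?S'")
    case now: True
    show ?thesis
    proof (cases "r \<in> ?S")
      case True
      then show ?thesis by (intro cops_capture_now) auto
    next
      case False
      have "r \<in> set (?m' @ g)" using now False by auto
      then show ?thesis using step[OF False] by (simp del: set_append) blast
    qed
  next
    case False
    then have r: "r \<notin> ?S" "r \<notin> ?S'" by auto
    have territory: "(r, w) \<in> avoid ?S" if "(r, w) \<in> avoid ?S'" for w
      using that
    proof (induction rule: rtrancl_induct)
      case (step y z)
      \<comment> \<open>If a cop left \<open>z\<close>, next to \<open>y\<close>, then towards the robber means towards \<open>y\<close>: it is on \<open>y\<close> now.\<close>
      have "z \<notin> set m"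
      proof
        assume z: "z \<in> set m"
        have "(r, y) \<in> avoid {z}" by (rule avoid_mono[OF _ step.IH]) (use z in auto)
        then have "toward z r = toward z y" by (rule toward_cong)
        also have "\<dots> = y" using step.hyps(2) sym_edges by (intro toward_eq) (auto dest: symD)
        finally have "y \<in> ?S'" using z by force
        then show False using step.hyps(2) by auto
      qed
      moreover have "y \<notin> ?S" using avoid_notin[OF step.IH] r by simp
      ultimately have "(y, z) \<in> Restr edges (- ?S)" using step.hyps(2) by auto
      with step.IH show ?case by (rule rtrancl_into_rtrancl)
    qed simp
    have "cops_capture G t (?m' @ g) r'" if move: "game_step G r r'" for r'
    proof (cases "r' \<in> ?S'")
      case True
      then show ?thesis by (intro cops_capture_now) auto
    next
      case r': False
      have rr': "(r, r') \<in> avoid ?S'"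
        using move guard[of r r'] r r' by (auto simp: game_step_def)
      show ?thesis
      proof (rule Suc.IH)
        show "set ?m' \<subseteq> V" using toward_step(1)[of _ r] Suc.prems(1,2) r edges_subset by fastforce
        show "r' \<in> V" using avoid_V[OF rr' Suc.prems(2)] .
        fix w assume "(r', w) \<in> avoid (set ?m' \<union> set g)"
        with rr' have "(r, w) \<in> avoid ?S'" by (rule rtrancl_trans)
        then have w: "(r, w) \<in> avoid ?S" by (rule territory)
        from Suc.prems(3)[OF this] obtain c where c: "c \<in> set m" "d c w \<le> Suc t" by blast
        have "(r, w) \<in> avoid {c}" by (rule avoid_mono[OF _ w]) (use c in auto)
        then have "toward c r = toward c w" by (rule toward_cong)
        moreover have "w \<noteq> c" using avoid_notin[OF w] r c by auto
        ultimately have "d (toward c r) w \<le> t"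
          using toward_step(2)[of c w] c Suc.prems(1) avoid_V[OF w Suc.prems(2)] by auto
        with c show "\<exists>c' \<in> set ?m'. d c' w \<le> t" by auto
      qed
    qed
    with step[OF r(1)] show ?thesis by auto
  qed
qed

end

section \<open>Spanning trees and fundamental cycles\<close>

text \<open>A breadth-first tree: the depth is the distance from \<open>x\<close>.\<close>

lemma (in connected_graph) ex_spanning_tree:
  assumes "x \<in> V"
  obtains par depth where "rooted_tree V x par depth" "rooted_tree.edges V x par \<subseteq> E"
proof -
  have "\<exists>u. (u, v) \<in> E \<and> d x v = Suc (d x u)" if v: "v \<in> V" "v \<noteq> x" for v
  proof -
    obtain k where k: "d x v = Suc k" using d_0_D[of x v] v assms by (cases "d x v") auto
    then obtain u where u: "(x, u) \<in> E ^^ k" "(u, v) \<in> E"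
      using d_walk[OF assms v(1)] by auto
    then have "u \<in> V" using edges_V by auto
    have "d x v \<le> Suc (d x u)"
      by (rule gdist_le, rule relpow_Suc_I[OF d_walk[OF assms \<open>u \<in> V\<close>] u(2)])
    then show ?thesis using gdist_le[OF u(1)] u(2) k by (intro exI[of _ u]) simp
  qed
  then obtain par where par: "\<And>v. v \<in> V \<Longrightarrow> v \<noteq> x \<Longrightarrow> (par v, v) \<in> E \<and> d x v = Suc (d x (par v))"
    by metis
  interpret T: rooted_tree V x par "d x"
    by unfold_locales (use par finite_V assms edges_V in auto)
  have "T.edges \<subseteq> E" using par sym_E by (auto simp: T.edges_def dest: symD)
  then show ?thesis using that T.rooted_tree_axioms by blast
qed

lemma pcas_snd_in: "pcas u p v \<Longrightarrow> e \<in> set p \<Longrightarrow> snd e \<in> insert v (fst ` set p)"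
proof (induction p arbitrary: u)
  case (Cons a p)
  show ?case
  proof (cases "e = a")
    case True
    with Cons.prems show ?thesis by (cases p) auto
  next
    case False
    with Cons show ?thesis by auto
  qed
qed simp

text \<open>
  Every edge outside a spanning connected subgraph \<open>T\<close> closes a cycle with a path of \<open>T\<close>, and
  it is the only edge of this cycle outside \<open>T\<close>, so different edges yield different cycles.
\<close>

lemma card_non_tree_edges_le:
  assumes G: "pair_graph G" and T: "T \<subseteq> parcs G" "sym T"
    and conn: "\<And>u v. u \<in> pverts G \<Longrightarrow> v \<in> pverts G \<Longrightarrow> (u, v) \<in> T\<^sup>*"
  shows "card {{u, v} |u v. (u, v) \<in> parcs G - T} \<le> num_cycles G"
proof -
  interpret G: pair_graph G by (rule G)
  let ?N = "{{u, v} |u v. (u, v) \<in> parcs G - T}"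
  let ?C = "{H. subgraph (with_proj H) (with_proj G) \<and> is_cycle_graph H}"
  let ?T = "\<lparr>pverts = pverts G, parcs = T\<rparr>"
  have "fst e \<in> pverts G \<and> snd e \<in> pverts G" if "e \<in> T" for e
    using that T(1) G.arc_fst_in_verts[of e] G.arc_snd_in_verts[of e] by blast
  then interpret T: pair_wf_digraph ?T by unfold_locales simp_all
  have cycle: "\<exists>H \<in> ?C. parcs H - T = {(u, v), (v, u)}" if uv: "(u, v) \<in> parcs G - T" for u v
  proof -
    have V: "u \<in> pverts G" "v \<in> pverts G" and "u \<noteq> v"
      using uv G.in_arcsD1 G.in_arcsD2 G.no_loops' by auto
    have vu: "(v, u) \<in> parcs G - T" using uv G.arcs_symmetric T(2) by (auto dest: symD)
    have "v \<rightarrow>\<^sup>*\<^bsub>with_proj ?T\<^esub> u"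
      using T.reachable_conv'[of v u] conn[OF V(2,1)] V by simp
    then obtain p where "T.apath v p u" using T.reachable_apath by blast
    then have p: "set p \<subseteq> T" "pcas v p u" "distinct (pawalk_verts v p)"
      by (auto simp: T.apath_def T.awalk_def)
    let ?p = "(u, v) # p"
    define H where "H = \<lparr>pverts = fst ` set ?p, parcs = set ?p \<union> (set ?p)\<inverse>\<rparr>"
    have closed: "pcas u ?p u" using p(2) by simp
    have snd_in: "snd e \<in> fst ` set ?p" if "e \<in> set ?p" for e
      using pcas_snd_in[OF closed that] by auto
    have arcs: "set ?p \<subseteq> parcs G" using p(1) T(1) uv by auto
    have arcsH: "parcs H \<subseteq> parcs G" using arcs G.arcs_symmetric by (auto simp: H_def)
    have vertsH: "pverts H \<subseteq> pverts G" using arcs G.in_arcsD1 by (auto simp: H_def)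
    have Hwf: "fst e \<in> pverts H \<and> snd e \<in> pverts H" if "e \<in> parcs H" for e
    proof -
      have "e \<in> set ?p \<or> (snd e, fst e) \<in> set ?p" using that by (cases e) (auto simp: H_def)
      then have "fst e \<in> fst ` set ?p \<and> snd e \<in> fst ` set ?p"
      proof
        assume "e \<in> set ?p"
        then show ?thesis using snd_in[of e] by blast
      next
        assume e: "(snd e, fst e) \<in> set ?p"
        then show ?thesis using snd_in[OF e] image_eqI[OF _ e, of "snd e" fst] by simp
      qed
      then show ?thesis by (simp add: H_def)
    qed
    have "pair_graph H"
    proof
      show "finite (parcs H)" by (simp add: H_def)
      show "finite (pverts H)" by (simp add: H_def)
      show "symmetric (with_proj H)" by (auto simp: symmetric_def H_def sym_def)
    qed (use Hwf arcsH G.no_loops' in auto)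
    moreover have "pre_digraph.cycle (with_proj H) ?p"
      unfolding pre_digraph.cycle_def pre_digraph.awalk_def
      by (rule exI[of _ u]) (use p closed in \<open>auto simp: H_def cas_with_proj_eq awalk_verts_with_proj_eq\<close>)
    moreover have "3 \<le> length ?p"
    proof (rule ccontr)
      assume "\<not> 3 \<le> length ?p"
      then consider "p = []" | e where "p = [e]" by (cases p; cases "tl p") auto
      then show False
      proof cases
        case 1
        then show False using p(2) \<open>u \<noteq> v\<close> by simp
      next
        case (2 e)
        then show False using p(1,2) vu by (cases e) auto
      qed
    qed
    ultimately have "is_cycle_graph H"
      unfolding is_cycle_graph_def by (intro conjI exI[of _ ?p]) (auto simp: H_def)
    moreover have "subgraph (with_proj H) (with_proj G)"
      using arcsH vertsH Hwf G.wf_digraph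
      by (auto simp: subgraph_def wf_digraph_wp_iff pair_wf_digraph_def)
    moreover have "parcs H - T = {(u, v), (v, u)}"
      using p(1) uv vu T(2) by (auto simp: H_def dest: symD)
    ultimately show ?thesis by blast
  qed
  have "\<forall>e\<in>?N. \<exists>H. H \<in> ?C \<and> {{u, v} |u v. (u, v) \<in> parcs H - T} = {e}"
  proof
    fix e assume "e \<in> ?N"
    then obtain u v where e: "e = {u, v}" "(u, v) \<in> parcs G - T" by blast
    from cycle[OF e(2)] obtain H where "H \<in> ?C" "parcs H - T = {(u, v), (v, u)}" by blast
    moreover from this(2) have "{{u, v} |u v. (u, v) \<in> parcs H - T} = {e}" by (auto simp: e(1))
    ultimately show "\<exists>H. H \<in> ?C \<and> {{u, v} |u v. (u, v) \<in> parcs H - T} = {e}" by blast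
  qed
  from bchoice[OF this] obtain f
    where f: "\<forall>e\<in>?N. f e \<in> ?C \<and> {{u, v} |u v. (u, v) \<in> parcs (f e) - T} = {e}" ..
  then have "inj_on f ?N"
    by (intro inj_on_inverseI[of _ "\<lambda>H. the_elem {{u, v} |u v. (u, v) \<in> parcs H - T}"])
       (simp only: the_elem_eq)
  moreover have "f ` ?N \<subseteq> ?C" using f by blast
  moreover have "finite ?C"
  proof (rule finite_subset)
    show "?C \<subseteq> (\<lambda>(A, B). \<lparr>pverts = A, parcs = B\<rparr>) ` (Pow (pverts G) \<times> Pow (parcs G))"
    proof
      fix H assume "H \<in> ?C"
      then have "pverts H \<subseteq> pverts G" "parcs H \<subseteq> parcs G" by (auto simp: subgraph_def)
      then show "H \<in> (\<lambda>(A, B). \<lparr>pverts = A, parcs = B\<rparr>) ` (Pow (pverts G) \<times> Pow (parcs G))"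
        by (intro image_eqI[of _ _ "(pverts H, parcs H)"]) auto
    qed
    show "finite ((\<lambda>(A, B). \<lparr>pverts = A, parcs = B\<rparr>) ` (Pow (pverts G) \<times> Pow (parcs G)))"
      using G.pair_finite_verts G.pair_finite_arcs by simp
  qed
  ultimately show ?thesis unfolding num_cycles_def by (rule card_inj_on_le)
qed

text \<open>
  A robber cannot use an edge with a cop on one of its ends.  One cop on an end of each edge outside
  \<open>T\<close> therefore confines him to \<open>T\<close>.
\<close>

lemma ex_guards:
  assumes "pair_graph G" "T \<subseteq> parcs G" "sym T"
    and "\<And>u v. u \<in> pverts G \<Longrightarrow> v \<in> pverts G \<Longrightarrow> (u, v) \<in> T\<^sup>*"
  obtains g where "length g \<le> num_cycles G" "set g \<subseteq> pverts G"
    "\<And>u v. (u, v) \<in> parcs G \<Longrightarrow> (u, v) \<in> T \<or> u \<in> set g \<or> v \<in> set g"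
proof -
  interpret G: pair_graph G by fact
  let ?N = "{{u, v} |u v. (u, v) \<in> parcs G - T}"
  let ?end = "\<lambda>e. SOME x. x \<in> e"
  have "?N \<subseteq> (\<lambda>(u, v). {u, v}) ` parcs G" by auto
  then have "finite ?N" by (rule finite_surj[OF G.pair_finite_arcs])
  from finite_distinct_list[OF this] obtain es where es: "set es = ?N" "distinct es" by blast
  have end_in: "?end e \<in> e" if "e \<in> ?N" for e
    unfolding some_in_eq using that by auto
  show ?thesis
  proof (rule that[of "map ?end es"])
    show "length (map ?end es) \<le> num_cycles G"
      using card_non_tree_edges_le[OF assms] distinct_card[OF es(2)] unfolding es(1) by simp
    have "e \<subseteq> pverts G" if "e \<in> ?N" for e using that G.in_arcsD1 G.in_arcsD2 by auto
    then show "set (map ?end es) \<subseteq> pverts G" unfolding set_map es(1) using end_in by blast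
    fix u v assume uv: "(u, v) \<in> parcs G"
    show "(u, v) \<in> T \<or> u \<in> set (map ?end es) \<or> v \<in> set (map ?end es)"
    proof (cases "(u, v) \<in> T")
      case False
      with uv have e: "{u, v} \<in> ?N" by blast
      then have "?end {u, v} \<in> set (map ?end es)" unfolding set_map es(1) by (rule imageI)
      moreover have "?end {u, v} = u \<or> ?end {u, v} = v" using end_in[OF e] by blast
      ultimately show ?thesis by metis
    qed simp
  qed
qed

section \<open>The throttling number\<close>

lemma th_c_le:
  assumes "c \<noteq> []" "set c \<subseteq> pverts G" "\<And>r. r \<in> pverts G \<Longrightarrow> cops_capture G t c r"
  shows "th_c G \<le> enat (length c + t)"
proof -
  have "capt (length c) G \<le> enat t"
    unfolding capt_def by (rule INF_lower) (use assms in blast)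
  moreover have "th_c G \<le> enat (length c) + capt (length c) G"
    unfolding th_c_def by (rule INF_lower) (use assms(1) in \<open>auto simp: Suc_le_eq\<close>)
  ultimately show ?thesis
    by (metis (no_types, lifting) add_left_mono order_trans plus_enat_simps(1))
qed

text \<open>
  With balls of radius \<open>3s\<close> and of radius \<open>4s\<close>, covers of sizes \<open>p\<close> and \<open>q\<close> that come with
  packings of the same size satisfy \<open>2s(p + q) \<le> n\<close>.  The better of \<open>p + 3s\<close> and \<open>q + 4s\<close> is at
  most their mean, hence at most \<open>n / (4s) + 7s / 2\<close>.  The term \<open>4s + 1\<close> accounts for a cover by a single ball of
  radius \<open>4s\<close>: there the counting breaks down, since a geodesic of length \<open>4s\<close> need not exist.
\<close>

lemma th_c_bound:
  fixes G :: "'a pair_pre_digraph"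
  assumes G: "pair_graph G" and conn: "Digraph_Component.connected (with_proj G)" and s: "s \<noteq> 0"
  obtains b where "th_c G \<le> enat b"
    "real b \<le> max (4 * real s + 1) (real (card (pverts G)) / (4 * real s) + 7 / 2 * real s)
       + real (num_cycles G)"
proof -
  interpret G: pair_graph G by (rule G)
  have sc: "strongly_connected (with_proj G)"
    using G.symmetric_connected_imp_strongly_connected[OF G.sym_arcs conn] .
  interpret C: connected_graph "pverts G" "parcs G"
  proof
    show "finite (pverts G)" by (rule G.pair_finite_verts)
    show "parcs G \<subseteq> pverts G \<times> pverts G" using G.in_arcsD1 G.in_arcsD2 by auto
    show "sym (parcs G)" using G.arcs_symmetric by (rule symI)
    show "(x, y) \<in> (parcs G)\<^sup>*" if "x \<in> pverts G" "y \<in> pverts G" for x y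
      using sc that G.reachable_conv'[of x y] by (auto simp: strongly_connected_def)
  qed
  obtain root where root: "root \<in> pverts G" using sc by (auto simp: strongly_connected_def)
  obtain par depth where T: "rooted_tree (pverts G) root par depth"
      and sub: "rooted_tree.edges (pverts G) root par \<subseteq> parcs G"
    using C.ex_spanning_tree[OF root] by blast
  interpret T: rooted_tree "pverts G" root par depth by (rule T)
  obtain g where g: "length g \<le> num_cycles G" "set g \<subseteq> pverts G"
      "\<And>u v. (u, v) \<in> parcs G \<Longrightarrow> (u, v) \<in> T.edges \<or> u \<in> set g \<or> v \<in> set g"
    using ex_guards[OF G sub T.sym_edges T.conn] by blast
  have capture: "th_c G \<le> enat (card C + t + num_cycles G)"
    if C: "C \<subseteq> pverts G" "\<forall>u \<in> pverts G. \<exists>c\<in>C. T.d c u \<le> t" for C t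
  proof -
    obtain m where m: "set m = C" "length m = card C"
      using finite_subset[OF C(1) G.pair_finite_verts] finite_distinct_list distinct_card by metis
    have "th_c G \<le> enat (length (m @ g) + t)"
    proof (rule th_c_le)
      show "m @ g \<noteq> []" using root C(2) m(1) by fastforce
      show "set (m @ g) \<subseteq> pverts G" using m(1) C(1) g(2) by simp
      fix r assume r: "r \<in> pverts G"
      show "cops_capture G t (m @ g) r"
      proof (rule T.chase[OF sub g(3)])
        show "set m \<subseteq> pverts G" "r \<in> pverts G" using m(1) C(1) r by auto
        fix w assume "(r, w) \<in> T.avoid (set m \<union> set g)"
        then have "w \<in> pverts G" using r by (rule T.avoid_V)
        then show "\<exists>c\<in>set m. T.d c w \<le> t" using C(2) m(1) by blast
      qed
    qed
    also have "\<dots> \<le> enat (card C + t + num_cycles G)" using g(1) m(2) by simp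
    finally show ?thesis .
  qed
  obtain P C where P: "P \<subseteq> pverts G" "C \<subseteq> pverts G" "card C \<le> card P"
      "\<forall>u\<in>pverts G. \<exists>c\<in>C. T.d c u \<le> 3 * s"
      "\<forall>p\<in>P. \<forall>p'\<in>P. p \<noteq> p' \<longrightarrow> 2 * (3 * s) < T.d p p'"
    using T.ex_cover_packing[OF order_refl, of "3 * s"] by blast
  obtain Q D where Q: "Q \<subseteq> pverts G" "D \<subseteq> pverts G" "card D \<le> card Q"
      "\<forall>u\<in>pverts G. \<exists>c\<in>D. T.d c u \<le> 4 * s"
      "\<forall>q\<in>Q. \<forall>q'\<in>Q. q \<noteq> q' \<longrightarrow> 2 * (4 * s) < T.d q q'"
    using T.ex_cover_packing[OF order_refl, of "4 * s"] by blast
  show ?thesis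
  proof (cases "2 \<le> card Q")
    case False
    then have "real (card D + 4 * s + num_cycles G) \<le> 4 * real s + 1 + real (num_cycles G)"
      using Q(3) by simp
    then show ?thesis using that[OF capture[OF Q(2,4)]] by (simp add: max_def split: if_splits)
  next
    case True
    have "(3 * s - s) * card P + 2 * s * card Q \<le> card (pverts G)"
      by (rule T.two_packings_le_card) (use P(1,5) Q(1,5) True in auto)
    moreover have "2 * s * (card C + card D) \<le> 2 * s * (card P + card Q)"
      by (intro mult_le_mono2 add_le_mono P(3) Q(3))
    moreover have "(3 * s - s) * card P + 2 * s * card Q = 2 * s * (card P + card Q)"
      by (simp add: distrib_left)
    ultimately have "2 * s * (card C + card D) \<le> card (pverts G)" by linarith
    then have "2 * real s * (real (card C) + real (card D)) \<le> real (card (pverts G))"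
      by (metis of_nat_add of_nat_le_iff of_nat_mult of_nat_numeral)
    then have sum: "(real (card C) + real (card D)) / 2 \<le> real (card (pverts G)) / (4 * real s)"
      using s by (simp add: field_simps)
    show ?thesis
    proof (cases "card C + 3 * s \<le> card D + 4 * s")
      case True
      then have "real (card C) + 3 * real s \<le> real (card D) + 4 * real s"
        by (metis of_nat_add of_nat_le_iff of_nat_mult of_nat_numeral)
      with sum show ?thesis by (intro that[OF capture[OF P(2,4)]]) simp
    next
      case False
      then have "real (card D) + 4 * real s \<le> real (card C) + 3 * real s"
        by (metis linear of_nat_add of_nat_le_iff of_nat_mult of_nat_numeral)
      with sum show ?thesis by (intro that[OF capture[OF Q(2,4)]]) simp
    qed
  qed
qed

theorem corollary3p4:
  fixes k :: "nat \<Rightarrow> nat"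
  assumes "(\<lambda>n. real (k n) / sqrt (real n)) \<longlonglongrightarrow> 0"
  shows "\<forall>\<epsilon>::real. \<epsilon> > 0 \<longrightarrow>
    (\<exists>N. \<forall>n\<ge>N. \<forall>G :: 'a pair_pre_digraph.
       pair_graph G \<and> Digraph_Component.connected (with_proj G) \<and>
       card (pverts G) = n \<and> num_cycles G \<le> k n \<longrightarrow>
       ereal_of_enat (th_c G) \<le> ereal ((sqrt 14 / 2 + \<epsilon>) * sqrt (real n)))"
proof (intro allI impI)
  fix \<epsilon> :: real assume \<epsilon>: "\<epsilon> > 0"
  have "eventually (\<lambda>n. real (k n) / sqrt (real n) < \<epsilon> / 2) sequentially"
    using order_tendstoD(2)[OF assms, of "\<epsilon> / 2"] \<epsilon> by simp
  moreover have "eventually (\<lambda>n. 5 \<le> \<epsilon> / 2 * sqrt (real n)) sequentially"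
  proof -
    have "filterlim (\<lambda>n. sqrt (real n)) at_top sequentially"
      by (rule filterlim_compose[OF sqrt_at_top filterlim_real_sequentially])
    then have "eventually (\<lambda>n. 10 / \<epsilon> \<le> sqrt (real n)) sequentially"
      by (simp add: filterlim_at_top)
    then show ?thesis by eventually_elim (use \<epsilon> in \<open>simp add: field_simps\<close>)
  qed
  moreover have "eventually (\<lambda>n::nat. n > 0) sequentially" by (rule eventually_gt_at_top)
  ultimately have "eventually (\<lambda>n. n > 0 \<and> 5 + real (k n) \<le> \<epsilon> * sqrt (real n)) sequentially"
  proof eventually_elim
    case (elim n)
    then have "real (k n) < \<epsilon> / 2 * sqrt (real n)" by (simp add: pos_divide_less_eq)
    with elim show ?case by (simp add: field_simps)
  qed
  then obtain N where N: "\<And>n. n \<ge> N \<Longrightarrow> n > 0 \<and> 5 + real (k n) \<le> \<epsilon> * sqrt (real n)"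
    by (auto simp: eventually_sequentially)
  show "\<exists>N. \<forall>n\<ge>N. \<forall>G :: 'a pair_pre_digraph.
       pair_graph G \<and> Digraph_Component.connected (with_proj G) \<and>
       card (pverts G) = n \<and> num_cycles G \<le> k n \<longrightarrow>
       ereal_of_enat (th_c G) \<le> ereal ((sqrt 14 / 2 + \<epsilon>) * sqrt (real n))"
  proof (intro exI[of _ N] allI impI, elim conjE)
    fix n and G :: "'a pair_pre_digraph"
    assume n: "N \<le> n" and G: "pair_graph G" "Digraph_Component.connected (with_proj G)"
      and card: "card (pverts G) = n" and cyc: "num_cycles G \<le> k n"
    \<comment> \<open>\<open>x = sqrt (n / 14)\<close> minimizes \<open>n / (4x) + 7x / 2\<close>, with the value \<open>7x = sqrt 14 / 2 * sqrt n\<close>.\<close>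
    define x where "x = sqrt (real n) / sqrt 14"
    define s where "s = nat \<lceil>x\<rceil>"
    have x: "x > 0" using N[OF n] by (simp add: x_def)
    have nx: "real n = 14 * x\<^sup>2" by (simp add: x_def power_divide)
    have "sqrt (real n) = sqrt 14 * x" by (simp add: x_def)
    then have "sqrt 14 / 2 * sqrt (real n) = (sqrt 14 * sqrt 14) / 2 * x"
      by (simp only: ac_simps times_divide_eq_left times_divide_eq_right)
    then have x7: "sqrt 14 / 2 * sqrt (real n) = 7 * x" by simp
    have s: "x \<le> real s" "real s \<le> x + 1" "s \<noteq> 0" using x unfolding s_def by linarith+
    obtain b where b: "th_c G \<le> enat b"
        "real b \<le> max (4 * real s + 1) (real n / (4 * real s) + 7 / 2 * real s) + real (num_cycles G)"
      using th_c_bound[OF G s(3)] card by blast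
    have "real n / (4 * real s) \<le> real n / (4 * x)"
      using s(1) x by (intro divide_left_mono) auto
    also have "\<dots> = 7 / 2 * x" using x by (simp add: nx power2_eq_square)
    \<comment> \<open>Rounding \<open>x\<close> up to \<open>s\<close> costs at most \<open>7 / 2\<close> in the second term; the first is at most \<open>4x + 5\<close>.\<close>
    finally have mx: "max (4 * real s + 1) (real n / (4 * real s) + 7 / 2 * real s) \<le> 7 * x + 5"
      using s(2) x by simp
    have "real b \<le> (7 * x + 5) + real (k n)"
      using b(2) mx cyc by linarith
    also have "\<dots> \<le> sqrt 14 / 2 * sqrt (real n) + \<epsilon> * sqrt (real n)"
      using N[OF n] x7 by linarith
    finally have "real b \<le> (sqrt 14 / 2 + \<epsilon>) * sqrt (real n)"
      by (simp only: distrib_right)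
    moreover have "ereal_of_enat (th_c G) \<le> ereal_of_enat (enat b)"
      using b(1) by (simp only: ereal_of_enat_le_iff)
    ultimately show "ereal_of_enat (th_c G) \<le> ereal ((sqrt 14 / 2 + \<epsilon>) * sqrt (real n))"
      using order_trans by fastforce
  qed
qed

end
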